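(* $\mathcal K_{\delta,0}g$ is in $C_0^\infty(D;\mathbb R^q)$ for all $g\in L^1(D;\mathbb R^q)$ and all $\delta\in(0,1]$.
   Context: $D\subset\mathbb R^d$ is an open, bounded, connected, strongly Lipschitz set. $C_0^\infty(D;\mathbb R^q)$ is the space of $\mathbb R^q$-valued functions of class $C^\infty$ with compact support in $D$. $B(\mathbf x,\rho)$ is the open Euclidean ball, $\|\cdot\|_{\ell^2}$ the Euclidean norm and induced norm on matrices and multilinear maps. Let $\mathbf x_D\in\mathbb R^d$, $r_D>0$ with $D\subset B(\mathbf x_D,r_D)$ be such that $\mathcal O:=B(\mathbf x_D,r_D)\setminus\overline D$ is a bounded open strongly Lipschitz set with $\partial D\subset\partial\mathcal O$. Let $\mathbf k\in C^\infty(\mathbb R^d;\mathbb R^d)$ be a fixed vector field, globally transversal for $\mathcal O$ and pointing outward $D$ (there is $\gamma>0$ with $-\mathbf n_{\mathcal O}\cdot\mathbf k\ge\gamma$ a.e. on $\partial\mathcal O$, $\mathbf n_{\mathcal O}$ the outward unit normal of $\mathcal O$), with $\|\mathbf k\|_{\ell^2}=1$ on $\partial\mathcal O$. Set $\boldsymbol\vartheta_\delta(\mathbf x)=\mathbf x+\delta\,\mathbf k(\mathbf x)$ and let $\zeta>0$ be fixed such that $\boldsymbol\vartheta_\delta(\mathcal O)+B(\mathbf 0,3\delta\zeta)\subset\mathcal O$ for all $\delta\in[0,1]$ (for $\delta=0$ the ball is understood as $\{\mathbf 0\}$). The kernel is $\rho(\mathbf y)=\eta\exp\left(-\frac{1}{1-\|\mathbf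 y\|_{\ell^2}^2}\right)$ if $\|\mathbf y\|_{\ell^2}<1$, $0$ otherwise, with $\eta$ such that $\int_{\mathbb R^d}\rho=1$. For a function $g$ on $D$, $\widetilde g$ denotes its extension by zero to $\mathbb R^d$. Let $q\ge1$ be an integer and, for $\delta\in[0,1]$, let $\mathbb B_\delta:D\to\mathbb R^{q\times q}$ be a smooth field such that for all $l\in\mathbb N$ there is $c$ with $\sup_{\mathbf x\in D}\|D^l(\mathbb B_\delta(\mathbf x)-\mathbb I)\|_{\ell^2}\le c\,\delta$. For $\mathbf x\in D$, $f\in L^1(D)$, $g\in L^1(D;\mathbb R^q)$, define $$(\mathcal K_{\delta,0}^{\mathrm g}f)(\mathbf x)=\int_{B(\mathbf 0,1)}\rho(\mathbf y)\widetilde f(\boldsymbol\vartheta_\delta(\mathbf x)+\delta\zeta\mathbf y)\,d\mathbf y,\qquad(\mathcal K_{\delta,0}g)(\mathbf x)=\mathbb B_\delta(\mathbf x)(\mathcal K_{\delta,0}^{\mathrm g}g_1(\mathbf x),\dots,\mathcal K_{\delta,0}^{\mathrm g}g_q(\mathbf x))^{\mathsf T}.$$ *)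

theory Defs
  imports "HOL-Analysis.Analysis"
begin

text \<open>
  \<open>dderiv f [v\<^sub>1,\<dots>,v\<^sub>l] x\<close> is \<open>D\<^sup>l f(x)(v\<^sub>1,\<dots>,v\<^sub>l)\<close>: the derivative of order \<open>l\<close> is taken as the
  multilinear map sending a list of \<open>l\<close> vectors to the iterated directional derivative.
\<close>

primrec dderiv ::
  "('a::euclidean_space \<Rightarrow> 'b::euclidean_space) \<Rightarrow> 'a list \<Rightarrow> 'a \<Rightarrow> 'b"
where
  "dderiv f [] = f"
| "dderiv f (v # vs) = (\<lambda>x. frechet_derivative (dderiv f vs) (at x) v)"

text \<open>
  Meant for open \<open>S\<close>; then it only depends on the values of \<open>f\<close> on \<open>S\<close>. As the dimension is finite,
  Frechet differentiability of \<open>D\<^sup>l f(\<cdot>)(v\<^sub>1,\<dots>,v\<^sub>l)\<close> for all directions is Frechet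
  differentiability of \<open>D\<^sup>l f\<close> itself.
\<close>

definition smooth_on :: "'a::euclidean_space set \<Rightarrow> ('a \<Rightarrow> 'b::euclidean_space) \<Rightarrow> bool" where
  "smooth_on S f \<longleftrightarrow> (\<forall>vs. \<forall>x\<in>S. dderiv f vs differentiable (at x))"

text \<open>\<open>C\<^sub>0\<^sup>\<infinity>(D)\<close>. Functions on \<open>D\<close> are total here; values outside \<open>D\<close> are ignored.\<close>

definition smooth_compact_support ::
  "'a::euclidean_space set \<Rightarrow> ('a \<Rightarrow> 'b::euclidean_space) \<Rightarrow> bool"
where
  "smooth_compact_support D f \<longleftrightarrow>
     smooth_on D f \<and>
     compact (closure {x \<in> D. f x \<noteq> 0}) \<and> closure {x \<in> D. f x \<noteq> 0} \<subseteq> D"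

text \<open>
  The induced norm of \<open>D\<^sup>l F(x)\<close> for a matrix field \<open>F\<close>: the supremum over directions in the closed
  unit ball of the operator norm of the matrix value. It is \<open>ennreal\<close>-valued so that suprema of it
  over \<open>x\<close> are meaningful without a boundedness proviso.
\<close>

definition matrix_deriv_norm ::
  "nat \<Rightarrow> ('a::euclidean_space \<Rightarrow> real^'n^'m) \<Rightarrow> 'a \<Rightarrow> ennreal"
where
  "matrix_deriv_norm l F x =
     (SUP vs \<in> {vs. length vs = l \<and> (\<forall>v\<in>set vs. norm v \<le> 1)}. ennreal (onorm ((*v) (dderiv F vs x))))"

text \<open>
  In the cylinder of radius \<open>b\<close> and half-height \<open>c\<close> around \<open>x\<^sub>0\<close> with axis \<open>\<nu>\<close>, the set \<open>S\<close> lies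
  strictly above (in direction \<open>\<nu>\<close>) the graph of the Lipschitz function \<open>\<phi>\<close>, which is defined on the
  hyperplane orthogonal to \<open>\<nu>\<close>, and the boundary of \<open>S\<close> is the graph. So \<open>\<nu>\<close> points into \<open>S\<close>.
\<close>

definition lipschitz_chart ::
  "'a::euclidean_space set \<Rightarrow> 'a \<Rightarrow> 'a \<Rightarrow> real \<Rightarrow> real \<Rightarrow> ('a \<Rightarrow> real) \<Rightarrow> bool"
where
  "lipschitz_chart S x\<^sub>0 \<nu> b c \<phi> \<longleftrightarrow>
     norm \<nu> = 1 \<and> b > 0 \<and> c > 0 \<and>
     (\<exists>L. L-lipschitz_on {h. h \<bullet> \<nu> = 0} \<phi>) \<and> \<phi> 0 = 0 \<and>
     (\<forall>h. h \<bullet> \<nu> = 0 \<and> norm h \<le> b \<longrightarrow> \<bar>\<phi> h\<bar> < c) \<and>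
     (\<forall>h t. h \<bullet> \<nu> = 0 \<and> norm h < b \<and> \<bar>t\<bar> < c \<longrightarrow>
        (x\<^sub>0 + h + t *\<^sub>R \<nu> \<in> S \<longleftrightarrow> t > \<phi> h) \<and>
        (x\<^sub>0 + h + t *\<^sub>R \<nu> \<in> frontier S \<longleftrightarrow> t = \<phi> h) \<and>
        (x\<^sub>0 + h + t *\<^sub>R \<nu> \<notin> closure S \<longleftrightarrow> t < \<phi> h))"

text \<open>
  For bounded sets (the only ones used) the boundary is compact, so no uniformity of the charts
  needs to be required.
\<close>

definition strongly_lipschitz :: "'a::euclidean_space set \<Rightarrow> bool" where
  "strongly_lipschitz S \<longleftrightarrow>
     open S \<and> (\<forall>x\<in>frontier S. \<exists>\<nu> b c \<phi>. lipschitz_chart S x \<nu> b c \<phi>)"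

text \<open>
  \<open>n\<close> is the outward unit normal of \<open>S\<close> at \<open>x\<close>: the graph function of a chart is differentiable at
  the base point with gradient \<open>p\<close> (in the hyperplane), and \<open>n = (p - \<nu>) / sqrt (1 + |p|\<^sup>2)\<close>.
\<close>

definition outward_unit_normal :: "'a::euclidean_space set \<Rightarrow> 'a \<Rightarrow> 'a \<Rightarrow> bool" where
  "outward_unit_normal S x n \<longleftrightarrow>
     (\<exists>\<nu> b c \<phi> p. lipschitz_chart S x \<nu> b c \<phi> \<and> p \<bullet> \<nu> = 0 \<and>
        (\<phi> has_derivative (\<lambda>h. p \<bullet> h)) (at 0 within {h. h \<bullet> \<nu> = 0}) \<and>
        n = (1 / sqrt (1 + (norm p)\<^sup>2)) *\<^sub>R (p - \<nu>))"

text \<open>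
  Hausdorff outer measure of integer dimension \<open>s\<close>, up to the normalising constant, which is
  irrelevant for null sets. The case distinction makes the empty set weightless also for \<open>s = 0\<close>.
\<close>

definition hausdorff_content ::
  "nat \<Rightarrow> real \<Rightarrow> 'a::euclidean_space set \<Rightarrow> ennreal"
where
  "hausdorff_content s \<epsilon> E =
     (INF U \<in> {U :: nat \<Rightarrow> 'a set. E \<subseteq> (\<Union>i. U i) \<and> (\<forall>i. bounded (U i) \<and> diameter (U i) \<le> \<epsilon>)}.
        \<Sum>i. if U i = {} then 0 else ennreal (diameter (U i) ^ s))"

definition hausdorff_outer_measure :: "nat \<Rightarrow> 'a::euclidean_space set \<Rightarrow> ennreal" where
  "hausdorff_outer_measure s E = (SUP \<epsilon>\<in>{0<..}. hausdorff_content s \<epsilon> E)"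

text \<open>``Almost everywhere on \<open>\<partial>S\<close>'' refers to surface measure.\<close>

definition ae_frontier :: "'a::euclidean_space set \<Rightarrow> ('a \<Rightarrow> bool) \<Rightarrow> bool" where
  "ae_frontier S P \<longleftrightarrow> hausdorff_outer_measure (DIM('a) - 1) {x \<in> frontier S. \<not> P x} = 0"

definition bump_kernel :: "real \<Rightarrow> 'a::euclidean_space \<Rightarrow> real" where
  "bump_kernel \<eta> y = (if norm y < 1 then \<eta> * exp (- (1 / (1 - (norm y)\<^sup>2))) else 0)"

definition zero_extension :: "'a set \<Rightarrow> ('a \<Rightarrow> real) \<Rightarrow> 'a \<Rightarrow> real" where
  "zero_extension D f x = (if x \<in> D then f x else 0)"

definition shift_map :: "('a::euclidean_space \<Rightarrow> 'a) \<Rightarrow> real \<Rightarrow> 'a \<Rightarrow> 'a" where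
  "shift_map k \<delta> x = x + \<delta> *\<^sub>R k x"

text \<open>
  \<open>K\<^sup>g\<^sub>\<delta>\<^sub>,\<^sub>0\<close> and \<open>K\<^sub>\<delta>\<^sub>,\<^sub>0\<close>. The completed measure is used because integrands are only
  Lebesgue measurable.
\<close>

definition mollify_scalar ::
  "real \<Rightarrow> ('a::euclidean_space \<Rightarrow> 'a) \<Rightarrow> real \<Rightarrow> 'a set \<Rightarrow> real \<Rightarrow> ('a \<Rightarrow> real) \<Rightarrow> 'a \<Rightarrow> real"
where
  "mollify_scalar \<eta> k \<zeta> D \<delta> f x =
     (LINT y : ball 0 1 | lebesgue.
        bump_kernel \<eta> y * zero_extension D f (shift_map k \<delta> x + (\<delta> * \<zeta>) *\<^sub>R y))"

definition mollify ::
  "real \<Rightarrow> ('a::euclidean_space \<Rightarrow> 'a) \<Rightarrow> real \<Rightarrow> 'a set \<Rightarrow> (real \<Rightarrow> 'a \<Rightarrow> real^'q^'q) \<Rightarrow>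
   real \<Rightarrow> ('a \<Rightarrow> real^'q) \<Rightarrow> 'a \<Rightarrow> real^'q"
where
  "mollify \<eta> k \<zeta> D B \<delta> g x =
     B \<delta> x *v (\<chi> i. mollify_scalar \<eta> k \<zeta> D \<delta> (\<lambda>z. g z $ i) x)"

end

theory Submission
  imports Defs
begin

text \<open>
  Substituting \<open>z = \<theta>\<^sub>\<delta>(x) + \<delta> \<zeta> y\<close> turns \<open>K\<^sup>g\<^sub>\<delta>\<^sub>,\<^sub>0 f\<close> into a constant multiple of \<open>F \<circ> \<theta>\<^sub>\<delta>\<close>, where \<open>F\<close>
  is the convolution of the integrable zero extension of \<open>f\<close> with a smooth compactly supported
  kernel; \<open>F\<close> may be differentiated under the integral because the kernel is uniformly
  differentiable. For the support, a boundary point \<open>x\<close> of \<open>D\<close> is a limit of points of \<open>\<O>\<close>, so the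
  ball of radius \<open>3 \<delta> \<zeta>\<close> around \<open>\<theta>\<^sub>\<delta>(x)\<close> lies in \<open>\<O>\<close>, and near \<open>x\<close> the integrand
  vanishes identically.
\<close>

subsection \<open>Calculus of smooth functions\<close>

text \<open>This recursion replaces the function by its directional derivatives, whereas
  \<open>dderiv\<close> adds each new derivative on the outside. Peeling from the inside suits
  inductions over all functions: the derivative fields are themselves instances of the induction
  hypothesis.\<close>

primrec times_differentiable_on ::
  "nat \<Rightarrow> 'a::euclidean_space set \<Rightarrow> ('a \<Rightarrow> 'b::euclidean_space) \<Rightarrow> bool"
where
  "times_differentiable_on 0 S f \<longleftrightarrow> True"
| "times_differentiable_on (Suc n) S f \<longleftrightarrow>
     (\<forall>x\<in>S. f differentiable (at x)) \<and>
     (\<forall>v. times_differentiable_on n S (\<lambda>x. frechet_derivative f (at x) v))"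

lemma dderiv_snoc: "dderiv f (vs @ [v]) = dderiv (\<lambda>x. frechet_derivative f (at x) v) vs"
  by (induction vs) auto

lemma times_differentiable_on_iff_dderiv:
  "times_differentiable_on n S f \<longleftrightarrow>
    (\<forall>vs. length vs < n \<longrightarrow> (\<forall>x\<in>S. dderiv f vs differentiable (at x)))"
proof (induction n arbitrary: f)
  case (Suc n)
  \<comment> \<open>Nonempty lists are split at their last element, since that is the direction in
    which \<open>dderiv\<close> differentiates \<open>f\<close> first.\<close>
  have *: "(\<forall>vs. length vs < Suc n \<longrightarrow> P vs) \<longleftrightarrow> P [] \<and> (\<forall>v vs. length vs < n \<longrightarrow> P (vs @ [v]))"
    for P :: "'a list \<Rightarrow> bool"
    by (metis Suc_less_eq length_append_singleton length_greater_0_conv list.size(3) rev_exhaust zero_less_Suc)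
  show ?case
    unfolding times_differentiable_on.simps Suc.IH * dderiv_snoc by auto
qed simp

lemma smooth_on_iff_times: "smooth_on S f \<longleftrightarrow> (\<forall>n. times_differentiable_on n S f)"
  unfolding smooth_on_def times_differentiable_on_iff_dderiv by blast

lemma times_differentiable_on_Suc_imp:
  "times_differentiable_on (Suc n) S f \<Longrightarrow> times_differentiable_on n S f"
  unfolding times_differentiable_on_iff_dderiv by auto

lemma times_differentiable_on_subset:
  "times_differentiable_on n T f \<Longrightarrow> S \<subseteq> T \<Longrightarrow> times_differentiable_on n S f"
  unfolding times_differentiable_on_iff_dderiv by blast

text \<open>On an open set, agreement at a point extends to a neighbourhood, so the derivatives
  agree on \<open>S\<close> too and the induction can pass to them.\<close>

lemma times_differentiable_on_cong:
  assumes "open S" "\<And>x. x \<in> S \<Longrightarrow> f x = g x" "times_differentiable_on n S f"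
  shows "times_differentiable_on n S g"
  using assms(2,3)
proof (induction n arbitrary: f g)
  case (Suc n)
  have d: "g differentiable (at x)" if "x \<in> S" for x
    using Suc.prems that assms(1)
    by (meson differentiable_def has_derivative_transform_within_open times_differentiable_on.simps(2))
  have e: "frechet_derivative f (at x) = frechet_derivative g (at x)" if "x \<in> S" for x
    using Suc.prems that assms(1) by (auto intro!: frechet_derivative_transform_within_open)
  have "times_differentiable_on n S (\<lambda>x. frechet_derivative g (at x) v)" for v
    by (rule Suc.IH[of "\<lambda>x. frechet_derivative f (at x) v"]) (use Suc.prems e in auto)
  then show ?case using d by simp
qed simp

text \<open>By uniqueness of the derivative, an explicit formula valid on \<open>S\<close> may stand
  in for \<open>frechet_derivative\<close>. The closure properties below are all inductions through
  this rule.\<close>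

lemma times_differentiable_on_SucI:
  assumes "open S" "\<And>x. x \<in> S \<Longrightarrow> (f has_derivative f' x) (at x)"
    "\<And>v. times_differentiable_on n S (\<lambda>x. f' x v)"
  shows "times_differentiable_on (Suc n) S f"
proof -
  have "f' x = frechet_derivative f (at x)" if "x \<in> S" for x
    using assms(2)[OF that] by (rule frechet_derivative_at)
  then have "times_differentiable_on n S (\<lambda>x. frechet_derivative f (at x) v)" for v
    by (intro times_differentiable_on_cong[OF assms(1) _ assms(3)[of v]]) auto
  moreover have "f differentiable (at x)" if "x \<in> S" for x
    using assms(2)[OF that] by (auto simp: differentiable_def)
  ultimately show ?thesis by simp
qed

lemma times_differentiable_on_SucD:
  assumes "times_differentiable_on (Suc n) S f" "x \<in> S"
  shows "(f has_derivative frechet_derivative f (at x)) (at x)"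
  using assms frechet_derivative_works by auto

section \<open>Closure under sums, linear and bilinear maps, and composition\<close>

lemma times_differentiable_on_const:
  "open S \<Longrightarrow> times_differentiable_on n S (\<lambda>x. c)"
proof (induction n arbitrary: c)
  case (Suc n)
  show ?case
    by (rule times_differentiable_on_SucI[OF Suc.prems has_derivative_const]) (rule Suc.IH[OF Suc.prems])
qed simp

lemma times_differentiable_on_add:
  assumes "open S" "times_differentiable_on n S f" "times_differentiable_on n S g"
  shows "times_differentiable_on n S (\<lambda>x. f x + g x)"
  using assms(2,3)
proof (induction n arbitrary: f g)
  case (Suc n)
  show ?case
  proof (rule times_differentiable_on_SucI[OF assms(1)])
    show "((\<lambda>x. f x + g x) has_derivative
        (\<lambda>v. frechet_derivative f (at x) v + frechet_derivative g (at x) v)) (at x)" if "x \<in> S" for x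
      using Suc.prems that by (intro has_derivative_add times_differentiable_on_SucD)
    show "times_differentiable_on n S
        (\<lambda>x. frechet_derivative f (at x) v + frechet_derivative g (at x) v)" for v
      using Suc by auto
  qed
qed simp

lemma times_differentiable_on_sum:
  assumes "open S" "finite I" "\<And>i. i \<in> I \<Longrightarrow> times_differentiable_on n S (f i)"
  shows "times_differentiable_on n S (\<lambda>x. \<Sum>i\<in>I. f i x)"
  using assms(2,3)
  by (induction I rule: finite_induct)
    (auto intro!: times_differentiable_on_add times_differentiable_on_const assms(1))

lemma times_differentiable_on_linear:
  assumes "open S" "bounded_linear L" "times_differentiable_on n S f"
  shows "times_differentiable_on n S (\<lambda>x. L (f x))"
  using assms(3)
proof (induction n arbitrary: f)
  case (Suc n)
  show ?case
  proof (rule times_differentiable_on_SucI[OF assms(1)])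
    show "((\<lambda>x. L (f x)) has_derivative (\<lambda>v. L (frechet_derivative f (at x) v))) (at x)"
      if "x \<in> S" for x
      using Suc.prems that
      by (intro bounded_linear.has_derivative[OF assms(2)] times_differentiable_on_SucD)
    show "times_differentiable_on n S (\<lambda>x. L (frechet_derivative f (at x) v))" for v
      using Suc by auto
  qed
qed simp

lemma times_differentiable_on_bilinear:
  assumes "open S" "bounded_bilinear M"
    "times_differentiable_on n S f" "times_differentiable_on n S g"
  shows "times_differentiable_on n S (\<lambda>x. M (f x) (g x))"
  using assms(3,4)
proof (induction n arbitrary: f g)
  case (Suc n)
  show ?case
  proof (rule times_differentiable_on_SucI[OF assms(1)])
    show "((\<lambda>x. M (f x) (g x)) has_derivative (\<lambda>v. M (f x) (frechet_derivative g (at x) v) +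
        M (frechet_derivative f (at x) v) (g x))) (at x)" if "x \<in> S" for x
      using Suc.prems that
      by (intro bounded_bilinear.FDERIV[OF assms(2)] times_differentiable_on_SucD)
    show "times_differentiable_on n S (\<lambda>x. M (f x) (frechet_derivative g (at x) v) +
        M (frechet_derivative f (at x) v) (g x))" for v
      \<comment> \<open>Each summand of the product rule has one undifferentiated factor, whose
        order is lowered with the recursion kept folded; the final \<open>auto\<close> unfolds it
        for the differentiated factor.\<close>
      using Suc.prems
      by (intro times_differentiable_on_add[OF assms(1)] Suc.IH)
        (auto intro: times_differentiable_on_Suc_imp simp del: times_differentiable_on.simps,
         auto)
  qed
qed simp

text \<open>In the chain rule the outer derivative is applied to a direction that varies with
  \<open>x\<close>, while the recursion only speaks of fixed directions. Expanding that direction in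
  \<open>Basis\<close> leaves sums of products of a coordinate of the derivative of \<open>g\<close>
  with a composition of \<open>g\<close> and a fixed-direction derivative of \<open>f\<close>, to
  which the induction hypothesis applies.\<close>

lemma times_differentiable_on_compose:
  assumes "open S" "open T" "g ` S \<subseteq> T"
    "times_differentiable_on n T f" "times_differentiable_on n S g"
  shows "times_differentiable_on n S (\<lambda>x. f (g x))"
  using assms(4,5)
proof (induction n arbitrary: f)
  case (Suc n)
  let ?f' = "\<lambda>x. frechet_derivative f (at x)" and ?g' = "\<lambda>x. frechet_derivative g (at x)"
  have f': "(f has_derivative ?f' (g x)) (at (g x))" if "x \<in> S" for x
    using times_differentiable_on_SucD[OF Suc.prems(1)] assms(3) that by blast
  show ?case
  proof (rule times_differentiable_on_SucI[OF assms(1)])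
    show "((\<lambda>x. f (g x)) has_derivative (\<lambda>v. \<Sum>b\<in>Basis. (?g' x v \<bullet> b) *\<^sub>R ?f' (g x) b)) (at x)"
      if "x \<in> S" for x
    proof -
      have "bounded_linear (?f' (g x))"
        using f'[OF that] by (rule has_derivative_bounded_linear)
      then have lin: "linear (?f' (g x))" by (rule bounded_linear.linear)
      have expand: "?f' (g x) w = (\<Sum>b\<in>Basis. (w \<bullet> b) *\<^sub>R ?f' (g x) b)" for w
        using lin by (subst euclidean_representation[of w, symmetric])
          (simp only: linear_sum linear_cmul o_def)
      have eq: "(\<lambda>v. \<Sum>b\<in>Basis. (?g' x v \<bullet> b) *\<^sub>R ?f' (g x) b) = (\<lambda>v. ?f' (g x) (?g' x v))"
        by (intro ext) (rule expand[symmetric])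
      show ?thesis unfolding eq
        using times_differentiable_on_SucD[OF Suc.prems(2) that] f'[OF that]
        by (rule has_derivative_compose)
    qed
    show "times_differentiable_on n S (\<lambda>x. \<Sum>b\<in>Basis. (?g' x v \<bullet> b) *\<^sub>R ?f' (g x) b)" for v
      using Suc.prems
      by (intro times_differentiable_on_sum[OF assms(1)]
          times_differentiable_on_bilinear[OF assms(1) bounded_bilinear_scaleR]
          times_differentiable_on_linear[OF assms(1) bounded_linear_inner_left] finite_Basis Suc.IH)
        (auto intro: times_differentiable_on_Suc_imp simp del: times_differentiable_on.simps,
         auto)
  qed
qed simp

lemma times_differentiable_on_ident:
  assumes "open S"
  shows "times_differentiable_on n S (\<lambda>x. x)"
proof (cases n)
  case (Suc m)
  show ?thesis unfolding Suc
    by (rule times_differentiable_on_SucI[OF assms has_derivative_ident])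
      (rule times_differentiable_on_const[OF assms])
qed simp

subsection \<open>Smoothness of the bump kernel\<close>

text \<open>
  The functions \<open>t \<mapsto> p(1/t) exp(-1/t)\<close>, extended by zero, form a class that is closed under
  differentiation.
\<close>

definition exp_inverse_poly :: "real poly \<Rightarrow> real \<Rightarrow> real" where
  "exp_inverse_poly p t = (if t > 0 then poly p (inverse t) * exp (- inverse t) else 0)"

lemma poly_div_exp_tendsto_0: "((\<lambda>u::real. poly p u / exp u) \<longlongrightarrow> 0) at_top"
proof -
  have "((\<lambda>u. \<Sum>i\<le>degree p. coeff p i * (u ^ i / exp u)) \<longlongrightarrow> (\<Sum>i\<le>degree p. coeff p i * 0)) at_top"
    by (intro tendsto_sum tendsto_mult tendsto_const tendsto_power_div_exp_0)
  then show ?thesis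
    by (simp add: poly_altdef sum_divide_distrib)
qed

text \<open>With u = 1/t, the derivative of p(u) exp(-u) for positive t is u^2 (p(u) - p'(u))
  exp(-u), which explains the new polynomial. The only delicate point is t = 0, where exponential
  decay beats every polynomial in u.\<close>

lemma exp_inverse_poly_has_derivative:
  "(exp_inverse_poly p has_real_derivative exp_inverse_poly (monom 1 2 * (p - pderiv p)) t) (at t)"
proof -
  consider "t > 0" | "t < 0" | "t = 0" by linarith
  then show ?thesis
  proof cases
    case 1
    have "((\<lambda>t. poly p (inverse t) * exp (- inverse t)) has_real_derivative
        exp_inverse_poly (monom 1 2 * (p - pderiv p)) t) (at t)"
      using 1 by (auto intro!: derivative_eq_intros DERIV_chain2[OF poly_DERIV]
          simp: exp_inverse_poly_def poly_monom power2_eq_square field_simps)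
    then show ?thesis
      by (rule has_field_derivative_transform_within_open[of _ _ _ "{0<..}"])
        (use 1 in \<open>auto simp: exp_inverse_poly_def\<close>)
  next
    case 2
    have "((\<lambda>t. 0) has_real_derivative 0) (at t)" by simp
    then have "(exp_inverse_poly p has_real_derivative 0) (at t)"
      by (rule has_field_derivative_transform_within_open[of _ _ _ "{..<0}"])
        (use 2 in \<open>auto simp: exp_inverse_poly_def\<close>)
    then show ?thesis using 2 by (simp add: exp_inverse_poly_def)
  next
    case 3
    \<comment> \<open>The difference quotient at 0 carries an extra factor 1/h; multiplying the
      polynomial by its variable, which is \<open>pCons 0 p\<close>, absorbs it.\<close>
    have "((\<lambda>h. poly (pCons 0 p) (inverse h) / exp (inverse h)) \<longlongrightarrow> 0) (at_right 0)"
      by (rule filterlim_compose[OF poly_div_exp_tendsto_0 filterlim_inverse_at_top_right])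
    then have "((\<lambda>h. exp_inverse_poly p h / h) \<longlongrightarrow> 0) (at_right 0)"
      by (rule Lim_transform_eventually)
        (auto simp: eventually_at_filter exp_inverse_poly_def exp_minus field_simps)
    moreover have "((\<lambda>h. exp_inverse_poly p h / h) \<longlongrightarrow> 0) (at_left 0)"
      by (rule Lim_transform_eventually[OF tendsto_const])
        (auto simp: eventually_at_filter exp_inverse_poly_def)
    ultimately have "((\<lambda>h. exp_inverse_poly p h / h) \<longlongrightarrow> 0) (at 0)"
      by (simp add: filterlim_at_split)
    then show ?thesis
      using 3 by (simp add: DERIV_def exp_inverse_poly_def)
  qed
qed

lemma times_differentiable_exp_inverse_poly:
  "times_differentiable_on n UNIV (exp_inverse_poly p)"
proof (induction n arbitrary: p)
  case (Suc n)
  show ?case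
  proof (rule times_differentiable_on_SucI[OF open_UNIV])
    show "(exp_inverse_poly p has_derivative
        (\<lambda>v. exp_inverse_poly (monom 1 2 * (p - pderiv p)) t * v)) (at t)" for t
      using exp_inverse_poly_has_derivative[of p t] by (simp add: has_field_derivative_def)
    show "times_differentiable_on n UNIV
        (\<lambda>t. exp_inverse_poly (monom 1 2 * (p - pderiv p)) t * v)" for v
      by (rule times_differentiable_on_linear[OF open_UNIV bounded_linear_mult_left Suc.IH])
  qed
qed simp

lemma smooth_bump_kernel:
  "smooth_on UNIV (bump_kernel \<eta> :: 'a::euclidean_space \<Rightarrow> real)"
proof -
  \<comment> \<open>Working with the squared norm avoids the singularity of the norm at the origin:
    the inner function is a polynomial in the coordinates.\<close>
  have eq: "bump_kernel \<eta> = (\<lambda>y::'a. \<eta> * exp_inverse_poly 1 (1 - y \<bullet> y))"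
  proof
    fix y :: 'a
    have "norm y < 1 \<longleftrightarrow> y \<bullet> y < 1"
      by (simp add: power2_norm_eq_inner[symmetric] abs_square_less_1)
    then show "bump_kernel \<eta> y = \<eta> * exp_inverse_poly 1 (1 - y \<bullet> y)"
      by (simp add: bump_kernel_def exp_inverse_poly_def power2_norm_eq_inner inverse_eq_divide)
  qed
  have sq: "times_differentiable_on n UNIV (\<lambda>y::'a. 1 + - (y \<bullet> y))" for n
    by (intro times_differentiable_on_add times_differentiable_on_const
        times_differentiable_on_linear[OF _ bounded_linear_minus[OF bounded_linear_ident]]
        times_differentiable_on_bilinear[OF _ bounded_bilinear_inner]
        times_differentiable_on_ident open_UNIV)
  have "times_differentiable_on n UNIV (\<lambda>y::'a. \<eta> * exp_inverse_poly 1 (1 + - (y \<bullet> y)))" for n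
    by (rule times_differentiable_on_linear[OF open_UNIV bounded_linear_mult_right
          times_differentiable_on_compose[OF open_UNIV open_UNIV subset_UNIV
            times_differentiable_exp_inverse_poly sq]])
  then show ?thesis
    unfolding smooth_on_iff_times eq by simp
qed

subsection \<open>Convolution with a smooth compactly supported kernel\<close>

text \<open>Heine-Cantor on a ball of radius \<open>R + 1\<close>. The margin 1 ensures that, for
  two points closer than 1, either both lie in this ball or both lie where \<open>f\<close>
  vanishes.\<close>

lemma uniformly_continuous_on_compact_support:
  fixes f :: "'a::euclidean_space \<Rightarrow> 'b::real_normed_vector"
  assumes "continuous_on UNIV f" "\<And>w. R < norm w \<Longrightarrow> f w = 0"
  shows "uniformly_continuous_on UNIV f"
proof -
  have unif: "uniformly_continuous_on (cball 0 (R + 1)) f"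
    using assms(1) by (intro compact_uniformly_continuous) (auto intro: continuous_on_subset)
  show ?thesis unfolding uniformly_continuous_on_def
  proof (intro allI impI)
    fix e :: real assume "e > 0"
    then obtain d where d: "d > 0"
      "\<And>x x'. x \<in> cball 0 (R + 1) \<Longrightarrow> x' \<in> cball 0 (R + 1) \<Longrightarrow> dist x' x < d \<Longrightarrow> dist (f x') (f x) < e"
      using unif unfolding uniformly_continuous_on_def by meson
    have "dist (f x') (f x) < e" if "dist x' x < min d 1" for x x'
    proof (cases "x \<in> cball 0 (R + 1) \<and> x' \<in> cball 0 (R + 1)")
      case False
      have "norm x' \<le> norm x + dist x' x" "norm x \<le> norm x' + dist x' x"
        by norm+
      then have "R < norm x" "R < norm x'" using False that by auto
      then show ?thesis using assms(2) \<open>e > 0\<close> by simp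
    qed (use d that in auto)
    then show "\<exists>d>0. \<forall>x\<in>UNIV. \<forall>x'\<in>UNIV. dist x' x < d \<longrightarrow> dist (f x') (f x) < e"
      using d(1) by (intro exI[of _ "min d 1"]) auto
  qed
qed

lemma bounded_on_compact_support:
  fixes f :: "'a::euclidean_space \<Rightarrow> 'b::real_normed_vector"
  assumes "continuous_on UNIV f" "\<And>w. R < norm w \<Longrightarrow> f w = 0"
  obtains C where "\<And>w. norm (f w) \<le> C"
proof -
  have "compact (f ` cball 0 R)"
    using assms(1) by (intro compact_continuous_image) (auto intro: continuous_on_subset)
  then obtain C where C: "\<And>w. norm w \<le> R \<Longrightarrow> norm (f w) \<le> C"
    using compact_imp_bounded by (force simp: bounded_iff)
  \<comment> \<open>The maximum with 0 covers the points outside the ball, since \<open>C\<close>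
    may be negative if the ball is empty.\<close>
  have "norm (f w) \<le> max C 0" for w
    using C[of w] assms(2)[of w] by (cases "norm w \<le> R") auto
  then show ?thesis using that by blast
qed

lemma smooth_on_imp_has_derivative:
  "smooth_on S f \<Longrightarrow> x \<in> S \<Longrightarrow> (f has_derivative frechet_derivative f (at x)) (at x)"
  by (meson smooth_on_iff_times times_differentiable_on_SucD)

lemma smooth_on_frechet_derivative:
  "smooth_on S f \<Longrightarrow> smooth_on S (\<lambda>x. frechet_derivative f (at x) v)"
  unfolding smooth_on_iff_times by (metis times_differentiable_on.simps(2))

lemma smooth_on_linear:
  "open S \<Longrightarrow> bounded_linear L \<Longrightarrow> smooth_on S f \<Longrightarrow> smooth_on S (\<lambda>x. L (f x))"
  unfolding smooth_on_iff_times by (simp add: times_differentiable_on_linear)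

lemma smooth_on_imp_continuous_on: "smooth_on S f \<Longrightarrow> continuous_on S f"
  by (meson continuous_at_imp_continuous_on has_derivative_continuous smooth_on_imp_has_derivative)

text \<open>The complement of the closed ball is open, so \<open>f\<close> is locally zero there.
  Hence derivatives of a kernel satisfy the same support bound and can serve as kernels
  again.\<close>

lemma frechet_derivative_zero_outside:
  assumes "\<And>w. R < norm w \<Longrightarrow> f w = 0" "R < norm w"
  shows "frechet_derivative f (at w) v = 0"
proof -
  have "open {w. R < norm w}"
    by (intro open_Collect_less continuous_intros)
  then have "(f has_derivative (\<lambda>v. 0)) (at w)"
    by (intro has_derivative_transform_within_open[OF has_derivative_const[of 0]])
      (use assms in auto)
  then have "(\<lambda>v. 0) = frechet_derivative f (at w)" by (rule frechet_derivative_at)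
  then show ?thesis by metis
qed

text \<open>The gradient is continuous with compact support, hence uniformly continuous, and the
  mean value inequality turns its modulus of continuity into a remainder estimate. The point is that
  \<open>d\<close> does not depend on \<open>w\<close>.\<close>

lemma uniformly_differentiable_compact_support:
  fixes \<psi> :: "'a::euclidean_space \<Rightarrow> real"
  assumes smooth: "smooth_on UNIV \<psi>" and supp: "\<And>w. R < norm w \<Longrightarrow> \<psi> w = 0" and "e > 0"
  obtains d where "d > 0"
    "\<And>w h. norm h < d \<Longrightarrow> \<bar>\<psi> (w + h) - \<psi> w - frechet_derivative \<psi> (at w) h\<bar> \<le> e * norm h"
proof -
  let ?D = "\<lambda>w. frechet_derivative \<psi> (at w)"
  \<comment> \<open>\<open>G\<close> is the gradient of \<open>\<psi>\<close>; having a vector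
    instead of a linear map allows uniform continuity to be applied directly.\<close>
  define G where "G w = (\<Sum>b\<in>Basis. ?D w b *\<^sub>R b)" for w
  have deriv: "(\<psi> has_derivative ?D w) (at w)" for w
    by (rule smooth_on_imp_has_derivative[OF smooth UNIV_I])
  have G: "?D w v = G w \<bullet> v" for w v
  proof -
    have "linear (?D w)"
      using deriv has_derivative_bounded_linear bounded_linear.linear by blast
    then have "?D w (\<Sum>b\<in>Basis. (v \<bullet> b) *\<^sub>R b) = (\<Sum>b\<in>Basis. (v \<bullet> b) *\<^sub>R ?D w b)"
      by (simp only: linear_sum linear_cmul o_def)
    also have "\<dots> = G w \<bullet> v"
      by (simp add: G_def inner_sum_left inner_sum_right inner_commute mult.commute)
    finally show ?thesis by (simp add: euclidean_representation)
  qed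
  have "continuous_on UNIV G"
    unfolding G_def
    by (intro continuous_intros smooth_on_imp_continuous_on smooth_on_frechet_derivative smooth)
  moreover have "G w = 0" if "R < norm w" for w
    using frechet_derivative_zero_outside[OF supp that] by (simp add: G_def)
  ultimately have "uniformly_continuous_on UNIV G"
    by (rule uniformly_continuous_on_compact_support)
  then obtain d where d: "d > 0" "\<And>x x'. dist x' x < d \<Longrightarrow> dist (G x') (G x) < e"
    using \<open>e > 0\<close> unfolding uniformly_continuous_on_def by (meson UNIV_I)
  have "\<bar>\<psi> (w + h) - \<psi> w - ?D w h\<bar> \<le> e * norm h" if h: "norm h < d" for w h
  proof -
    \<comment> \<open>The mean value inequality is used for \<open>\<psi>\<close> minus its linear
      part at \<open>w\<close>; the gradient of this difference at \<open>u\<close> is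
      \<open>G u - G w\<close>, of norm at most \<open>e\<close> on the ball.\<close>
    have "norm ((\<psi> (w + h) - G w \<bullet> (w + h)) - (\<psi> w - G w \<bullet> w)) \<le> e * norm ((w + h) - w)"
    proof (rule differentiable_bound[where S = "ball w d"])
      show "((\<lambda>u. \<psi> u - G w \<bullet> u) has_derivative (\<lambda>v. (G u - G w) \<bullet> v)) (at u within ball w d)"
        if "u \<in> ball w d" for u
        using has_derivative_at_withinI[OF deriv[of u]]
        by (auto intro!: derivative_eq_intros simp: G inner_diff_left)
      show "onorm (\<lambda>v. (G u - G w) \<bullet> v) \<le> e" if "u \<in> ball w d" for u
      proof (rule onorm_bound)
        show "norm ((G u - G w) \<bullet> v) \<le> e * norm v" for v
        proof -
          have "norm ((G u - G w) \<bullet> v) \<le> norm (G u - G w) * norm v"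
            by (simp add: Cauchy_Schwarz_ineq2)
          also have "\<dots> \<le> e * norm v"
            using d(2)[of u w] that by (intro mult_right_mono) (auto simp: dist_norm norm_minus_commute)
          finally show ?thesis .
        qed
      qed (use \<open>e > 0\<close> in simp)
    qed (use h d(1) in \<open>auto simp: dist_norm\<close>)
    then show ?thesis by (simp add: G inner_add_right algebra_simps)
  qed
  then show ?thesis using that d(1) by blast
qed

section \<open>Differentiation under the integral sign\<close>

lemma integrable_translate_kernel:
  fixes f :: "'a::euclidean_space \<Rightarrow> 'b::euclidean_space" and \<psi> :: "'a \<Rightarrow> real"
  assumes f: "integrable lebesgue f"
    and cont: "continuous_on UNIV \<psi>" and supp: "\<And>w. R < norm w \<Longrightarrow> \<psi> w = 0"
  shows "integrable lebesgue (\<lambda>z. \<psi> (z - p) *\<^sub>R f z)"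
proof -
  obtain C where C: "\<And>w. norm (\<psi> w) \<le> C"
    using bounded_on_compact_support[OF cont supp] by blast
  have "continuous_on UNIV (\<lambda>z. \<psi> (z - p))"
    by (rule continuous_on_compose2[OF cont]) (auto intro: continuous_intros)
  then have "(\<lambda>z. \<psi> (z - p)) \<in> borel_measurable lebesgue"
    by (intro borel_measurable_continuous_onI measurable_completion) (simp add: borel_measurable_continuous_onI)
  then have "(\<lambda>z. \<psi> (z - p) *\<^sub>R f z) \<in> borel_measurable lebesgue"
    using f by (intro borel_measurable_scaleR) auto
  moreover have "integrable lebesgue (\<lambda>z. C * norm (f z))"
    using f by (intro integrable_mult_right integrable_norm)
  moreover have "norm (\<psi> (z - p) *\<^sub>R f z) \<le> norm (C * norm (f z))" for z
    using C[of "z - p"] by (auto intro!: mult_right_mono simp: abs_mult)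
  ultimately show ?thesis
    by (metis (no_types, lifting) AE_I2 Bochner_Integration.integrable_bound)
qed

text \<open>The remainder estimate for \<open>\<psi>\<close> is uniform in \<open>z\<close>, so
  integrating it against the norm of \<open>f\<close> bounds the remainder of the convolution. The
  minus sign arises because \<open>p\<close> enters as \<open>z - p\<close>.\<close>

lemma convolution_has_derivative:
  fixes f :: "'a::euclidean_space \<Rightarrow> 'b::euclidean_space" and \<psi> :: "'a \<Rightarrow> real"
  assumes f: "integrable lebesgue f"
    and smooth: "smooth_on UNIV \<psi>" and supp: "\<And>w. R < norm w \<Longrightarrow> \<psi> w = 0"
  shows "((\<lambda>p. LINT z|lebesgue. \<psi> (z - p) *\<^sub>R f z) has_derivative
    (\<lambda>v. LINT z|lebesgue. - frechet_derivative \<psi> (at (z - p)) v *\<^sub>R f z)) (at p)"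
    (is "(?F has_derivative ?F') (at p)")
proof -
  let ?D = "\<lambda>w. frechet_derivative \<psi> (at w)"
  have int: "integrable lebesgue (\<lambda>z. \<psi> (z - q) *\<^sub>R f z)" for q
    by (rule integrable_translate_kernel[OF f smooth_on_imp_continuous_on[OF smooth] supp])
  have int': "integrable lebesgue (\<lambda>z. - ?D (z - p) v *\<^sub>R f z)" for v
  proof -
    have "continuous_on UNIV (\<lambda>w. - ?D w v)"
      by (intro continuous_intros smooth_on_imp_continuous_on smooth_on_frechet_derivative smooth)
    moreover have "- ?D w v = 0" if "R < norm w" for w
      using frechet_derivative_zero_outside[OF supp that] by simp
    ultimately show ?thesis by (rule integrable_translate_kernel[OF f])
  qed
  have lin: "linear (?D w)" for w
    using smooth_on_imp_has_derivative[OF smooth UNIV_I]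
    by (blast intro: has_derivative_bounded_linear bounded_linear.linear)
  have "linear ?F'"
  proof (rule linearI)
    show "?F' (u + v) = ?F' u + ?F' v" for u v
    proof -
      have "?F' (u + v) =
          (LINT z|lebesgue. - ?D (z - p) u *\<^sub>R f z + - ?D (z - p) v *\<^sub>R f z)"
        by (simp add: linear_add[OF lin] scaleR_left_diff_distrib)
      also have "\<dots> = ?F' u + ?F' v"
        by (rule Bochner_Integration.integral_add[OF int' int'])
      finally show ?thesis .
    qed
    show "?F' (c *\<^sub>R u) = c *\<^sub>R ?F' u" for c u
    proof -
      have "?F' (c *\<^sub>R u) = (LINT z|lebesgue. c *\<^sub>R (- ?D (z - p) u *\<^sub>R f z))"
        by (simp add: linear_cmul[OF lin])
      also have "\<dots> = c *\<^sub>R ?F' u"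
        by (rule integral_scaleR_right)
      finally show ?thesis .
    qed
  qed
  then have "bounded_linear ?F'" by (simp add: linear_conv_bounded_linear)
  moreover have "\<exists>d>0. \<forall>y. norm (y - p) < d \<longrightarrow>
      norm (?F y - ?F p - ?F' (y - p)) \<le> e * norm (y - p)" if "e > 0" for e
  proof -
    define N where "N = (LINT z|lebesgue. norm (f z))"
    have "N \<ge> 0" by (simp add: N_def)
    \<comment> \<open>The integrated remainder is at most \<open>e' * N * norm (y - p)\<close>; the
      summand 1 avoids division by zero when \<open>N\<close> is 0.\<close>
    define e' where "e' = e / (N + 1)"
    have "e' > 0" using \<open>e > 0\<close> \<open>N \<ge> 0\<close> by (simp add: e'_def)
    then obtain d where d: "d > 0"
      "\<And>w h. norm h < d \<Longrightarrow> \<bar>\<psi> (w + h) - \<psi> w - ?D w h\<bar> \<le> e' * norm h"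
      using uniformly_differentiable_compact_support[OF smooth supp] by blast
    have "norm (?F y - ?F p - ?F' (y - p)) \<le> e * norm (y - p)" if "norm (y - p) < d" for y
    proof -
      have "?F y - ?F p - ?F' (y - p) =
          (LINT z|lebesgue. \<psi> (z - y) *\<^sub>R f z - \<psi> (z - p) *\<^sub>R f z - - ?D (z - p) (y - p) *\<^sub>R f z)"
        using int int' by (simp only: Bochner_Integration.integral_diff Bochner_Integration.integrable_diff)
      also have "norm \<dots> \<le> (LINT z|lebesgue. e' * norm (y - p) * norm (f z))"
      proof (rule Bochner_Integration.integral_norm_bound_integral)
        fix z
        \<comment> \<open>Moving the centre from \<open>p\<close> to \<open>y\<close> shifts the
          argument of the kernel by \<open>p - y\<close>; linearity of the derivative accounts for
          the change of sign.\<close>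
        have "\<psi> (z - y) *\<^sub>R f z - \<psi> (z - p) *\<^sub>R f z - - ?D (z - p) (y - p) *\<^sub>R f z =
            (\<psi> ((z - p) + (p - y)) - \<psi> (z - p) - ?D (z - p) (p - y)) *\<^sub>R f z"
          using linear_neg[OF lin, of "z - p" "y - p"] by (simp add: algebra_simps)
        then show "norm (\<psi> (z - y) *\<^sub>R f z - \<psi> (z - p) *\<^sub>R f z - - ?D (z - p) (y - p) *\<^sub>R f z)
            \<le> e' * norm (y - p) * norm (f z)"
          using d(2)[of "p - y" "z - p"] that
          by (auto intro!: mult_right_mono simp: norm_minus_commute)
      qed (use f int int' in \<open>auto intro!: Bochner_Integration.integrable_diff\<close>)
      also have "\<dots> = e' * N * norm (y - p)"
        by (simp add: N_def)
      also have "\<dots> \<le> e * norm (y - p)"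
        using \<open>e > 0\<close> \<open>N \<ge> 0\<close> by (intro mult_right_mono) (auto simp: e'_def field_simps)
      finally show ?thesis .
    qed
    then show ?thesis using d(1) by blast
  qed
  ultimately show ?thesis unfolding has_derivative_at_alt by blast
qed

text \<open>Each directional derivative is again a convolution of \<open>f\<close>, with a kernel
  that is smooth and obeys the same support bound, so induction on the order with the kernel
  arbitrary applies.\<close>

lemma smooth_on_convolution:
  fixes f :: "'a::euclidean_space \<Rightarrow> 'b::euclidean_space" and \<psi> :: "'a \<Rightarrow> real"
  assumes f: "integrable lebesgue f"
    and smooth: "smooth_on UNIV \<psi>" and supp: "\<And>w. R < norm w \<Longrightarrow> \<psi> w = 0"
  shows "smooth_on UNIV (\<lambda>p. LINT z|lebesgue. \<psi> (z - p) *\<^sub>R f z)"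
proof -
  have "times_differentiable_on n UNIV (\<lambda>p. LINT z|lebesgue. \<psi> (z - p) *\<^sub>R f z)" for n
    using smooth supp
  proof (induction n arbitrary: \<psi>)
    case (Suc n)
    show ?case
    proof (rule times_differentiable_on_SucI[OF open_UNIV])
      show "((\<lambda>p. LINT z|lebesgue. \<psi> (z - p) *\<^sub>R f z) has_derivative
          (\<lambda>v. LINT z|lebesgue. - frechet_derivative \<psi> (at (z - p)) v *\<^sub>R f z)) (at p)" for p
        by (rule convolution_has_derivative[OF f Suc.prems])
      show "times_differentiable_on n UNIV
          (\<lambda>p. LINT z|lebesgue. - frechet_derivative \<psi> (at (z - p)) v *\<^sub>R f z)" for v
      proof (rule Suc.IH)
        show "smooth_on UNIV (\<lambda>w. - frechet_derivative \<psi> (at w) v)"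
          by (rule smooth_on_linear[OF open_UNIV bounded_linear_minus[OF bounded_linear_ident]
                smooth_on_frechet_derivative[OF Suc.prems(1)]])
        show "- frechet_derivative \<psi> (at w) v = 0" if "R < norm w" for w
          using frechet_derivative_zero_outside[OF Suc.prems(2) that] by simp
      qed
    qed
  qed simp
  then show ?thesis by (simp add: smooth_on_iff_times)
qed

subsection \<open>The mollified functions\<close>

lemma integral_lebesgue_affine:
  fixes h :: "'a::euclidean_space \<Rightarrow> 'b::euclidean_space"
  assumes "c > 0" and h: "h \<in> borel_measurable lebesgue"
  shows "(LINT z|lebesgue. h z) = c ^ DIM('a) *\<^sub>R (LINT y|lebesgue. h (t + c *\<^sub>R y))"
proof -
  let ?T = "\<lambda>y. t + c *\<^sub>R y"
  \<comment> \<open>The affine change of variables for Lebesgue measure scales each coordinate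
    separately; here all factors equal \<open>c\<close>, which gives the Jacobian
    \<open>c ^ DIM('a)\<close>.\<close>
  have T: "t + (\<Sum>j\<in>Basis. (c * (y \<bullet> j)) *\<^sub>R j) = ?T y" for y
    by (simp add: euclidean_representation flip: scaleR_scaleR scaleR_sum_right)
  have leb: "lebesgue = density (distr lebesgue lebesgue ?T) (\<lambda>_. ennreal (c ^ DIM('a)))"
    using lebesgue_affine_euclidean[of "\<lambda>_. c" t] \<open>c > 0\<close> by (simp add: T)
  have meas: "?T \<in> lebesgue \<rightarrow>\<^sub>M lebesgue"
    using lebesgue_affine_measurable[of "\<lambda>_. c" t] \<open>c > 0\<close> by (simp add: T)
  have "(LINT z|lebesgue. h z) =
      (LINT z|density (distr lebesgue lebesgue ?T) (\<lambda>_. ennreal (c ^ DIM('a))). h z)"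
    using leb by simp
  also have "\<dots> = (LINT z|distr lebesgue lebesgue ?T. c ^ DIM('a) *\<^sub>R h z)"
    by (rule integral_density) (use h \<open>c > 0\<close> in auto)
  also have "\<dots> = (LINT y|lebesgue. c ^ DIM('a) *\<^sub>R h (?T y))"
    by (rule integral_distr[OF meas]) (use h in auto)
  finally show ?thesis by simp
qed

lemma smooth_on_mollify_scalar:
  fixes D :: "'a::euclidean_space set"
  assumes "s > 0" "s = \<delta> * \<zeta>" and f: "integrable lebesgue (zero_extension D f)"
    and k: "smooth_on UNIV k"
  shows "smooth_on UNIV (mollify_scalar \<eta> k \<zeta> D \<delta> f)"
proof -
  \<comment> \<open>After the substitution
    \<open>z = x + \<delta> *\<^sub>R k x + s *\<^sub>R y\<close> the variable \<open>x\<close> sits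
    only in the translation of this rescaled kernel and no longer in the possibly rough function
    \<open>f\<close>.\<close>
  define \<psi> where "\<psi> w = bump_kernel \<eta> ((1 / s) *\<^sub>R w)" for w :: 'a
  define F where "F p = (LINT z|lebesgue. \<psi> (z - p) *\<^sub>R zero_extension D f z)" for p
  have \<psi>: "smooth_on UNIV \<psi>"
    unfolding \<psi>_def smooth_on_iff_times
  proof
    fix n
    have "times_differentiable_on n UNIV (\<lambda>w::'a. (1 / s) *\<^sub>R w)"
      by (rule times_differentiable_on_linear[OF open_UNIV bounded_linear_scaleR_right
            times_differentiable_on_ident[OF open_UNIV]])
    then show "times_differentiable_on n UNIV (\<lambda>w::'a. bump_kernel \<eta> ((1 / s) *\<^sub>R w))"
      by (rule times_differentiable_on_compose[OF open_UNIV open_UNIV subset_UNIV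
            smooth_bump_kernel[unfolded smooth_on_iff_times, rule_format]])
  qed
  have \<psi>_supp: "\<psi> w = 0" if "s < norm w" for w
    using that \<open>s > 0\<close> by (simp add: \<psi>_def bump_kernel_def field_simps)
  have F: "smooth_on UNIV F"
    unfolding F_def by (rule smooth_on_convolution[OF f \<psi> \<psi>_supp])
  have eq: "mollify_scalar \<eta> k \<zeta> D \<delta> f x = (1 / s ^ DIM('a)) *\<^sub>R F (x + \<delta> *\<^sub>R k x)" for x
  proof -
    let ?p = "x + \<delta> *\<^sub>R k x"
    \<comment> \<open>The integral over the unit ball becomes one over the whole space because the
      kernel vanishes off the ball.\<close>
    have "mollify_scalar \<eta> k \<zeta> D \<delta> f x =
        (LINT y|lebesgue. \<psi> ((?p + s *\<^sub>R y) - ?p) *\<^sub>R zero_extension D f (?p + s *\<^sub>R y))"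
      unfolding mollify_scalar_def set_lebesgue_integral_def shift_map_def \<psi>_def
      using \<open>s > 0\<close> by (intro Bochner_Integration.integral_cong)
        (auto simp: assms(2) indicator_def bump_kernel_def)
    moreover have "F ?p = s ^ DIM('a) *\<^sub>R
        (LINT y|lebesgue. \<psi> ((?p + s *\<^sub>R y) - ?p) *\<^sub>R zero_extension D f (?p + s *\<^sub>R y))"
      unfolding F_def
      by (rule integral_lebesgue_affine[OF \<open>s > 0\<close>], rule borel_measurable_integrable,
          rule integrable_translate_kernel[OF f smooth_on_imp_continuous_on[OF \<psi>] \<psi>_supp])
    ultimately show ?thesis using \<open>s > 0\<close> by simp
  qed
  have "times_differentiable_on n UNIV (\<lambda>x. (1 / s ^ DIM('a)) *\<^sub>R F (x + \<delta> *\<^sub>R k x))" for n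
  proof -
    have "times_differentiable_on n UNIV (\<lambda>x. x + \<delta> *\<^sub>R k x)"
      by (rule times_differentiable_on_add[OF open_UNIV times_differentiable_on_ident[OF open_UNIV]
            times_differentiable_on_linear[OF open_UNIV bounded_linear_scaleR_right]])
        (use k in \<open>simp add: smooth_on_iff_times\<close>)
    then have "times_differentiable_on n UNIV (\<lambda>x. F (x + \<delta> *\<^sub>R k x))"
      by (rule times_differentiable_on_compose[OF open_UNIV open_UNIV subset_UNIV
            F[unfolded smooth_on_iff_times, rule_format]])
    then show ?thesis
      by (rule times_differentiable_on_linear[OF open_UNIV bounded_linear_scaleR_right])
  qed
  then show ?thesis
    unfolding smooth_on_iff_times eq[abs_def] by blast
qed

lemma bounded_bilinear_matrix_vector_mult:
  "bounded_bilinear ((*v) :: real^'n^'m \<Rightarrow> real^'n \<Rightarrow> real^'m)"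
  unfolding bilinear_conv_bounded_bilinear[symmetric] bilinear_def
  by (simp add: linear_iff matrix_vector_mult_add_rdistrib matrix_vector_right_distrib
      matrix_vector_mult_scaleR scaleR_matrix_vector_assoc)

lemma smooth_on_mollify:
  fixes D :: "(real^'d) set" and g :: "real^'d \<Rightarrow> real^'q"
  assumes "open D" "\<delta> * \<zeta> > 0" and g: "g absolutely_integrable_on D"
    and k: "smooth_on UNIV k" and B: "smooth_on D (B \<delta>)"
  shows "smooth_on D (mollify \<eta> k \<zeta> D B \<delta> g)"
  unfolding smooth_on_iff_times
proof
  fix n
  let ?m = "\<lambda>i. mollify_scalar \<eta> k \<zeta> D \<delta> (\<lambda>z. g z $ i)"
  have "integrable lebesgue (zero_extension D (\<lambda>z. g z $ i))" for i
  proof -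
    have "integrable lebesgue (\<lambda>z. (indicator D z *\<^sub>R g z) \<bullet> axis i 1)"
      using g unfolding set_integrable_def by (intro integrable_inner_left)
    moreover have "(\<lambda>z. (indicator D z *\<^sub>R g z) \<bullet> axis i 1) = zero_extension D (\<lambda>z. g z $ i)"
      by (auto simp: zero_extension_def fun_eq_iff inner_axis indicator_def)
    ultimately show ?thesis by simp
  qed
  then have m: "times_differentiable_on n D (?m i)" for i
    using smooth_on_mollify_scalar[OF assms(2) refl _ k] unfolding smooth_on_iff_times
    by (blast intro: times_differentiable_on_subset[OF _ subset_UNIV])
  \<comment> \<open>Writing the vector as a combination of the axes reduces its smoothness to that
    of the scalar components.\<close>
  have "(\<chi> i. ?m i x) = (\<Sum>i\<in>UNIV. ?m i x *\<^sub>R axis i 1)" for x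
    using basis_expansion[of "\<chi> i. ?m i x"] by (simp add: scalar_mult_eq_scaleR)
  moreover have "times_differentiable_on n D (\<lambda>x. \<Sum>i\<in>UNIV. ?m i x *\<^sub>R (axis i 1 :: real^'q))"
    by (rule times_differentiable_on_sum[OF assms(1) finite_class.finite_UNIV
          times_differentiable_on_linear[OF assms(1) bounded_linear_scaleR_left m]])
  ultimately have "times_differentiable_on n D (\<lambda>x. B \<delta> x *v (\<chi> i. ?m i x))"
    using B unfolding smooth_on_iff_times
    by (intro times_differentiable_on_bilinear[OF assms(1) bounded_bilinear_matrix_vector_mult])
      simp_all
  then show "times_differentiable_on n D (mollify \<eta> k \<zeta> D B \<delta> g)"
    unfolding mollify_def[abs_def] .
qed

section \<open>Vanishing near the boundary and compact support\<close>

lemma mollify_eq_0: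
  assumes "\<And>y. norm y < 1 \<Longrightarrow> shift_map k \<delta> x + (\<delta> * \<zeta>) *\<^sub>R y \<notin> D"
  shows "mollify \<eta> k \<zeta> D B \<delta> g x = 0"
proof -
  have "mollify_scalar \<eta> k \<zeta> D \<delta> f x = 0" for f
    unfolding mollify_scalar_def set_lebesgue_integral_def
    by (rule integral_eq_zero_AE) (auto simp: zero_extension_def assms indicator_def)
  then show ?thesis by (simp add: mollify_def zero_vec_def[symmetric])
qed

theorem lemma4p1:
  fixes D \<O> :: "(real^'d) set"
    and x\<^sub>D :: "real^'d" and r\<^sub>D \<gamma> \<zeta> \<eta> :: real
    and k :: "real^'d \<Rightarrow> real^'d"
    and B :: "real \<Rightarrow> real^'d \<Rightarrow> real^'q^'q"
  assumes D: "open D" "bounded D" "connected D" "strongly_lipschitz D"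
    and ball: "r\<^sub>D > 0" "D \<subseteq> ball x\<^sub>D r\<^sub>D"
    and O_def: "\<O> = ball x\<^sub>D r\<^sub>D - closure D"
    and \<O>: "open \<O>" "bounded \<O>" "strongly_lipschitz \<O>" "frontier D \<subseteq> frontier \<O>"
    and k_smooth: "smooth_on UNIV k"
    and k_transversal: "\<gamma> > 0"
      "ae_frontier \<O> (\<lambda>x. \<exists>n. outward_unit_normal \<O> x n \<and> - n \<bullet> k x \<ge> \<gamma>)"
    and k_norm: "\<forall>x\<in>frontier \<O>. norm (k x) = 1"
    and \<zeta>: "\<zeta> > 0"
      "\<forall>\<delta>\<in>{0..1}. {shift_map k \<delta> x + w | x w. x \<in> \<O> \<and> w \<in> insert 0 (ball 0 (3 * \<delta> * \<zeta>))} \<subseteq> \<O>"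
    and \<eta>: "has_bochner_integral lborel (bump_kernel \<eta> :: real^'d \<Rightarrow> real) 1"
    and B_smooth: "\<forall>\<delta>\<in>{0..1}. smooth_on D (B \<delta>)"
    and B_bound: "\<forall>l. \<exists>c\<ge>0. \<forall>\<delta>\<in>{0..1}.
      (SUP x\<in>D. matrix_deriv_norm l (\<lambda>x. B \<delta> x - mat 1) x) \<le> ennreal (c * \<delta>)"
  shows "\<forall>g :: real^'d \<Rightarrow> real^'q. g absolutely_integrable_on D \<longrightarrow>
    (\<forall>\<delta>\<in>{0<..1}. smooth_compact_support D (mollify \<eta> k \<zeta> D B \<delta> g))"
proof (intro allI impI ballI)
  fix g :: "real^'d \<Rightarrow> real^'q" and \<delta> :: real
  assume g: "g absolutely_integrable_on D" and \<delta>: "\<delta> \<in> {0<..1}"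
  let ?\<theta> = "shift_map k \<delta>" and ?m = "mollify \<eta> k \<zeta> D B \<delta> g"
  define s where "s = \<delta> * \<zeta>"
  have "s > 0" using \<delta> \<zeta>(1) by (simp add: s_def)
  have cont: "isCont ?\<theta> x" for x
    using smooth_on_imp_continuous_on[OF k_smooth] unfolding shift_map_def[abs_def]
    by (intro continuous_intros) (simp add: continuous_on_eq_continuous_at)
  have "x \<notin> closure {x \<in> D. ?m x \<noteq> 0}" if x: "x \<in> frontier D" for x
  proof -
    obtain d where "d > 0" and d: "\<And>y. dist y x < d \<Longrightarrow> dist (?\<theta> y) (?\<theta> x) < s"
      using cont[of x] \<open>s > 0\<close> unfolding continuous_at_eps_delta by blast
    \<comment> \<open>The choice of \<open>\<zeta>\<close> gives information only at points of
      \<open>\<O>\<close>, so the boundary point \<open>x\<close> is replaced by a nearby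
      \<open>z\<close> in \<open>\<O>\<close>.\<close>
    have "x \<in> closure \<O>" using x \<O>(4) by (auto simp: frontier_def)
    then obtain z where z: "z \<in> \<O>" "dist z x < d"
      using \<open>d > 0\<close> by (meson closure_approachable)
    have "?m y = 0" if y: "dist y x < d" for y
    proof (rule mollify_eq_0)
      fix w :: "real^'d" assume w: "norm w < 1"
      \<comment> \<open>This is the displacement from \<open>?\<theta> z\<close> to the sampled
        point. Passing from \<open>?\<theta> y\<close> to \<open>?\<theta> z\<close> through
        \<open>?\<theta> x\<close> costs less than \<open>2 * s\<close>, and the kernel radius less
        than \<open>s\<close>; this uses up the factor 3 in the hypothesis on
        \<open>\<zeta>\<close>.\<close>
      let ?v = "?\<theta> y - ?\<theta> z + s *\<^sub>R w"
      have "norm (s *\<^sub>R w) < s" using w \<open>s > 0\<close> by simp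
      moreover have "norm (?\<theta> y - ?\<theta> z) < 2 * s"
        using d[OF y] d[OF z(2)] dist_triangle2[of "?\<theta> y" "?\<theta> z" "?\<theta> x"]
        unfolding dist_norm by linarith
      moreover have "norm ?v \<le> norm (?\<theta> y - ?\<theta> z) + norm (s *\<^sub>R w)"
        by (rule norm_triangle_ineq)
      ultimately have "norm ?v < 3 * s" by linarith
      then have "?v \<in> ball 0 (3 * \<delta> * \<zeta>)" by (simp add: s_def mult.assoc)
      then have "?\<theta> z + ?v \<in>
          {?\<theta> x + w | x w. x \<in> \<O> \<and> w \<in> insert 0 (ball 0 (3 * \<delta> * \<zeta>))}"
        using z(1) by blast
      moreover have "\<delta> \<in> {0..1}" using \<delta> by simp
      ultimately have "?\<theta> z + ?v \<in> \<O>" using \<zeta>(2) by blast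
      then have "?\<theta> y + s *\<^sub>R w \<in> \<O>" by simp
      then show "?\<theta> y + (\<delta> * \<zeta>) *\<^sub>R w \<notin> D"
        using closure_subset[of D] by (auto simp: O_def s_def)
    qed
    then show ?thesis using \<open>d > 0\<close> by (force simp: closure_approachable)
  qed
  \<comment> \<open>The closed support lies in \<open>D\<close> together with its frontier, and the
    frontier has just been excluded; compactness then follows from boundedness of
    \<open>D\<close>.\<close>
  moreover have "closure {x \<in> D. ?m x \<noteq> 0} \<subseteq> closure D"
    by (intro closure_mono) auto
  moreover have "closure D \<subseteq> D \<union> frontier D"
    using interior_open[OF D(1)] by (auto simp: frontier_def)
  ultimately have "closure {x \<in> D. ?m x \<noteq> 0} \<subseteq> D" by blast
  moreover have "compact (closure {x \<in> D. ?m x \<noteq> 0})"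
    using D(2) by (simp add: compact_closure bounded_subset)
  moreover have "smooth_on D ?m"
    by (rule smooth_on_mollify) (use D(1) g k_smooth B_smooth \<delta> \<zeta>(1) in auto)
  ultimately show "smooth_compact_support D ?m"
    by (simp add: smooth_compact_support_def)
qed

end
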